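(* For each $u\in\{1,2,3\}$, the function $$\mu_u(x)=x_u\left(1+\frac{x_0}{\vec q}\right)$$ is $V_q$-regular on $\mathbb H^*=\{q=x_0+\vec q\in\mathbb H:\ \vec q\neq 0\}$.
   Context: $\mathbb H$ denotes the quaternions with units $\mathbf e_1,\mathbf e_2,\mathbf e_3$ ($\mathbf e_1^2=\mathbf e_2^2=\mathbf e_3^2=-1$, $\mathbf e_1\mathbf e_2=-\mathbf e_2\mathbf e_1=\mathbf e_3$, and cyclically). A point $x=(x_0,x_1,x_2,x_3)\in\mathbb R^4$ is identified with $q=x_0+\vec q$, where $\vec q=x_1\mathbf e_1+x_2\mathbf e_2+x_3\mathbf e_3$. For $\vec q\ne0$, $\frac1{\vec q}$ is the quaternionic inverse of $\vec q$. The operator $V_q$ acts on quaternion-valued functions that are $C^1$ in the real variables on open subsets of $\mathbb H^*$ by $$V_qf=\frac{\partial f}{\partial x_0}-\frac1{\vec q}\sum_{u=1}^3x_u\frac{\partial f}{\partial x_u}$$ (left multiplication by $\frac1{\vec q}$). A quaternion-valued function $f$ that is at least $C^1$ is called $V_q$-regular if $V_qf=0$. *)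

theory Defs
  imports "HOL-Analysis.Analysis"
begin

section \<open>Quaternions\<close>

datatype quat = Quat (qre: real) (qi: real) (qj: real) (qk: real)

lemma quat_eq_iff: "p = q \<longleftrightarrow> qre p = qre q \<and> qi p = qi q \<and> qj p = qj q \<and> qk p = qk q"
  by (cases p; cases q) auto

text \<open>
  The type \<open>quat\<close> also plays the role of \<open>\<real>\<^sup>4\<close>: its norm is the Euclidean norm of the four
  coordinates, and its topology is the one induced by this norm.
\<close>

instantiation quat :: ab_group_add
begin

definition "0 = Quat 0 0 0 0"
definition "p + q = Quat (qre p + qre q) (qi p + qi q) (qj p + qj q) (qk p + qk q)"
definition "p - q = Quat (qre p - qre q) (qi p - qi q) (qj p - qj q) (qk p - qk q)"
definition "- q = Quat (- qre q) (- qi q) (- qj q) (- qk q)"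

instance
  by standard (simp_all add: quat_eq_iff zero_quat_def plus_quat_def minus_quat_def uminus_quat_def)

end

lemma quat_sel_zero [simp]: "qre 0 = 0" "qi 0 = 0" "qj 0 = 0" "qk 0 = 0"
  by (simp_all add: zero_quat_def)

lemma quat_sel_add [simp]:
  "qre (p + q) = qre p + qre q" "qi (p + q) = qi p + qi q"
  "qj (p + q) = qj p + qj q" "qk (p + q) = qk p + qk q"
  by (simp_all add: plus_quat_def)

lemma quat_sel_diff [simp]:
  "qre (p - q) = qre p - qre q" "qi (p - q) = qi p - qi q"
  "qj (p - q) = qj p - qj q" "qk (p - q) = qk p - qk q"
  by (simp_all add: minus_quat_def)

lemma quat_sel_minus [simp]:
  "qre (- q) = - qre q" "qi (- q) = - qi q" "qj (- q) = - qj q" "qk (- q) = - qk q"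
  by (simp_all add: uminus_quat_def)

instantiation quat :: real_vector
begin

definition "r *\<^sub>R q = Quat (r * qre q) (r * qi q) (r * qj q) (r * qk q)"

instance
  by standard (simp_all add: quat_eq_iff scaleR_quat_def algebra_simps)

end

lemma quat_sel_scaleR [simp]:
  "qre (r *\<^sub>R q) = r * qre q" "qi (r *\<^sub>R q) = r * qi q"
  "qj (r *\<^sub>R q) = r * qj q" "qk (r *\<^sub>R q) = r * qk q"
  by (simp_all add: scaleR_quat_def)

instantiation quat :: real_inner
begin

definition "inner p q = qre p * qre q + qi p * qi q + qj p * qj q + qk p * qk q"
definition "norm q = sqrt (inner q q)" for q :: quat
definition "sgn q = q /\<^sub>R norm q" for q :: quat
definition "dist p q = norm (p - q)" for p q :: quat
definition [code del]:
  "(uniformity :: (quat \<times> quat) filter) = (INF e\<in>{0 <..}. principal {(p, q). dist p q < e})"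
definition [code del]:
  "open (S :: quat set) \<longleftrightarrow> (\<forall>p\<in>S. \<forall>\<^sub>F (p', q) in uniformity. p' = p \<longrightarrow> q \<in> S)"

instance
proof
  fix p q r :: quat and a b :: real
  show "inner p q = inner q p"
    by (simp add: inner_quat_def algebra_simps)
  show "inner (p + q) r = inner p r + inner q r"
    by (simp add: inner_quat_def algebra_simps)
  show "inner (a *\<^sub>R p) q = a * inner p q"
    by (simp add: inner_quat_def scaleR_quat_def algebra_simps)
  show "0 \<le> inner p p"
    by (simp add: inner_quat_def)
  show "inner p p = 0 \<longleftrightarrow> p = 0"
    by (auto simp: inner_quat_def quat_eq_iff add_nonneg_eq_0_iff)
qed (simp_all only: norm_quat_def sgn_quat_def dist_quat_def uniformity_quat_def open_quat_def)

end

instantiation quat :: real_normed_div_algebra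
begin

definition "1 = Quat 1 0 0 0"
definition
  "p * q = Quat
     (qre p * qre q - qi p * qi q - qj p * qj q - qk p * qk q)
     (qre p * qi q + qi p * qre q + qj p * qk q - qk p * qj q)
     (qre p * qj q - qi p * qk q + qj p * qre q + qk p * qi q)
     (qre p * qk q + qi p * qj q - qj p * qi q + qk p * qre q)"
definition "inverse q = Quat (qre q) (- qi q) (- qj q) (- qk q) /\<^sub>R (norm q)\<^sup>2"
definition "p div q = p * inverse q" for p q :: quat

instance
proof
  fix p q r :: quat and a :: real
  have sq: "(norm p)\<^sup>2 = (qre p)\<^sup>2 + (qi p)\<^sup>2 + (qj p)\<^sup>2 + (qk p)\<^sup>2" for p :: quat
    unfolding power2_norm_eq_inner by (simp add: inner_quat_def power2_eq_square)
  show "p * q * r = p * (q * r)"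
    by (simp add: quat_eq_iff times_quat_def algebra_simps)
  show "(p + q) * r = p * r + q * r" "p * (q + r) = p * q + p * r"
    by (simp_all add: quat_eq_iff times_quat_def algebra_simps)
  show "1 * p = p" "p * 1 = p" "(0 :: quat) \<noteq> 1"
    by (simp_all add: quat_eq_iff times_quat_def one_quat_def)
  show "a *\<^sub>R p * q = a *\<^sub>R (p * q)" "p * a *\<^sub>R q = a *\<^sub>R (p * q)"
    by (simp_all add: quat_eq_iff times_quat_def algebra_simps)
  show "inverse p * p = 1" "p * inverse p = 1" if "p \<noteq> 0"
  proof -
    define n where "n = (norm p)\<^sup>2"
    have n: "n \<noteq> 0" "n = (qre p)\<^sup>2 + (qi p)\<^sup>2 + (qj p)\<^sup>2 + (qk p)\<^sup>2"
      using that by (simp_all add: n_def flip: sq)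
    show "inverse p * p = 1" "p * inverse p = 1"
      using n(1) unfolding quat_eq_iff times_quat_def inverse_quat_def one_quat_def n_def [symmetric]
      by (simp_all add: divide_simps) (simp_all add: n(2) power2_eq_square algebra_simps)
  qed
  show "p div q = p * inverse q"
    by (fact divide_quat_def)
  show "inverse (0 :: quat) = 0"
    by (simp add: inverse_quat_def)
  have "(norm (p * q))\<^sup>2 = (norm p * norm q)\<^sup>2"
    unfolding power_mult_distrib sq
    by (simp add: times_quat_def power2_eq_square algebra_simps)
  then show "norm (p * q) = norm p * norm q"
    by (simp add: norm_quat_def flip: norm_quat_def)
qed

end

text \<open>
  Index \<open>0\<close> refers to the real part, indices \<open>1, 2, 3\<close> to the imaginary ones; other indices are
  not used.
\<close>

definition qunit :: "nat \<Rightarrow> quat" where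
  "qunit u =
     (if u = 0 then 1 else if u = 1 then Quat 0 1 0 0 else if u = 2 then Quat 0 0 1 0
      else if u = 3 then Quat 0 0 0 1 else 0)"

definition coord :: "nat \<Rightarrow> quat \<Rightarrow> real" where
  "coord u q =
     (if u = 0 then qre q else if u = 1 then qi q else if u = 2 then qj q
      else if u = 3 then qk q else 0)"

lemma qunit_mult:
  "qunit 1 * qunit 1 = -1" "qunit 2 * qunit 2 = -1" "qunit 3 * qunit 3 = -1"
  "qunit 1 * qunit 2 = qunit 3" "qunit 2 * qunit 1 = - qunit 3"
  "qunit 2 * qunit 3 = qunit 1" "qunit 3 * qunit 2 = - qunit 1"
  "qunit 3 * qunit 1 = qunit 2" "qunit 1 * qunit 3 = - qunit 2"
  by (simp_all add: qunit_def times_quat_def quat_eq_iff one_quat_def)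

definition vec_part :: "quat \<Rightarrow> quat" where
  "vec_part q = (\<Sum>u=1..3. coord u q *\<^sub>R qunit u)"

lemma quat_decomp: "q = of_real (coord 0 q) + vec_part q"
proof -
  have "{1..3} = {1, 2, 3 :: nat}"
    by auto
  then show ?thesis
    by (simp add: vec_part_def quat_eq_iff coord_def qunit_def of_real_def one_quat_def
        times_quat_def)
qed

definition Hstar :: "quat set" where
  "Hstar = {q. vec_part q \<noteq> 0}"


section \<open>\<open>V\<^sub>q\<close>-regular functions\<close>

definition pderiv_at :: "nat \<Rightarrow> (quat \<Rightarrow> quat) \<Rightarrow> quat \<Rightarrow> quat" where
  "pderiv_at u f q = vector_derivative (\<lambda>t. f (q + t *\<^sub>R qunit u)) (at 0)"

text \<open>
  Functions on an open set \<open>S\<close> are represented by total functions; as \<open>S\<close> is open, the values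
  outside \<open>S\<close> do not influence the partial derivatives at points of \<open>S\<close>.
\<close>

definition C1_on :: "quat set \<Rightarrow> (quat \<Rightarrow> quat) \<Rightarrow> bool" where
  "C1_on S f \<longleftrightarrow> open S \<and>
     (\<forall>u\<in>{0..3}. (\<forall>q\<in>S. (\<lambda>t. f (q + t *\<^sub>R qunit u)) differentiable (at 0)) \<and>
                 continuous_on S (pderiv_at u f))"

definition V_op :: "(quat \<Rightarrow> quat) \<Rightarrow> quat \<Rightarrow> quat" where
  "V_op f q =
     pderiv_at 0 f q - inverse (vec_part q) * (\<Sum>u=1..3. coord u q *\<^sub>R pderiv_at u f q)"

definition V_regular_on :: "quat set \<Rightarrow> (quat \<Rightarrow> quat) \<Rightarrow> bool" where
  "V_regular_on S f \<longleftrightarrow> S \<subseteq> Hstar \<and> C1_on S f \<and> (\<forall>q\<in>S. V_op f q = 0)"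

definition mu :: "nat \<Rightarrow> quat \<Rightarrow> quat" where
  "mu u q = coord u q *\<^sub>R (1 + coord 0 q *\<^sub>R inverse (vec_part q))"

end

theory Submission
  imports Defs
begin

text \<open>
  Let \<open>v\<close> be the vector part. In \<open>(x\<^sub>1, x\<^sub>2, x\<^sub>3)\<close> the function \<open>x\<^sub>u\<close> is homogeneous of degree 1
  and \<open>x\<^sub>u x\<^sub>0 / v\<close> of degree 0. By Euler's identity the operator \<open>\<Sum> x\<^sub>k \<partial>\<^sub>k\<close> therefore maps \<open>\<mu>\<^sub>u\<close>
  to \<open>x\<^sub>u\<close>, and \<open>x\<^sub>u / v\<close> is also the \<open>x\<^sub>0\<close>-derivative of \<open>\<mu>\<^sub>u\<close>.
\<close>

text \<open>Linearity and boundedness of \<open>coord u\<close> are inherited from the inner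
  product. For \<open>u > 3\<close> both sides are 0.\<close>

lemma coord_eq_inner: "coord u q = inner q (qunit u)"
  by (simp add: coord_def qunit_def inner_quat_def one_quat_def)

lemma bounded_linear_coord: "bounded_linear (coord u)"
  unfolding coord_eq_inner [abs_def] by (rule bounded_linear_inner_left)

lemma vec_part_eq: "vec_part q = Quat 0 (qi q) (qj q) (qk q)"
  \<comment> \<open>Comparing components in the decomposition determines \<open>vec_part q\<close>
    without expanding its sum.\<close>
  using quat_decomp [of q]
  by (simp add: quat_eq_iff coord_def of_real_def one_quat_def)

lemma bounded_linear_vec_part: "bounded_linear vec_part"
  unfolding vec_part_def
  by (intro bounded_linear_sum bounded_linear_compose [OF bounded_linear_scaleR_left]
      bounded_linear_coord)

lemma vec_part_vec_part [simp]: "vec_part (vec_part q) = vec_part q"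
  by (simp add: vec_part_eq)

lemma coord_vec_part: "coord u (vec_part q) = (if u = 0 then 0 else coord u q)"
  by (simp add: vec_part_eq coord_def)

lemma vec_part_one [simp]: "vec_part 1 = 0"
  by (simp add: vec_part_eq one_quat_def quat_eq_iff)

lemma coord_one: "coord u 1 = (if u = 0 then 1 else 0)"
  by (simp add: coord_def one_quat_def)

lemma continuous_on_coord [continuous_intros]:
  "continuous_on S f \<Longrightarrow> continuous_on S (\<lambda>x. coord u (f x))"
  by (rule bounded_linear.continuous_on [OF bounded_linear_coord])

lemma continuous_on_vec_part [continuous_intros]:
  "continuous_on S f \<Longrightarrow> continuous_on S (\<lambda>x. vec_part (f x))"
  by (rule bounded_linear.continuous_on [OF bounded_linear_vec_part])

lemma open_Hstar: "open Hstar"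
  unfolding Hstar_def by (intro open_Collect_neq continuous_intros)

text \<open>Chain rule along a line, which reduces partial derivatives to values of the total
  derivative.\<close>

lemma has_vector_derivative_along_line:
  fixes f :: "'a::real_normed_vector \<Rightarrow> 'b::real_normed_vector"
  assumes "(f has_derivative D) (at x)"
  shows "((\<lambda>t. f (x + t *\<^sub>R e)) has_vector_derivative D e) (at 0)"
proof -
  interpret D: bounded_linear D
    using assms by (rule has_derivative_bounded_linear)
  have line: "((\<lambda>t. x + t *\<^sub>R e) has_derivative (\<lambda>t. t *\<^sub>R e)) (at 0)"
    by (auto intro!: derivative_eq_intros)
  have "((\<lambda>t. f (x + t *\<^sub>R e)) has_derivative (\<lambda>t. D (t *\<^sub>R e))) (at 0)"
    by (rule has_derivative_compose [OF line]) (use assms in simp)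
  then show ?thesis
    by (simp add: has_vector_derivative_def D.scaleR)
qed

lemma pderiv_at_eq:
  assumes "(f has_derivative D) (at q)"
  shows "pderiv_at u f q = D (qunit u)"
  unfolding pderiv_at_def
  by (rule vector_derivative_at [OF has_vector_derivative_along_line [OF assms]])

text \<open>By linearity of \<open>D\<close>, the Euler operator is the directional derivative along
  \<open>vec_part q\<close>, whose coefficients in the units are the
  \<open>coord u q\<close>.\<close>

lemma sum_coord_pderiv_at:
  assumes "(f has_derivative D) (at q)"
  shows "(\<Sum>u=1..3. coord u q *\<^sub>R pderiv_at u f q) = D (vec_part q)"
proof -
  interpret D: bounded_linear D
    using assms by (rule has_derivative_bounded_linear)
  show ?thesis
    by (simp add: vec_part_def pderiv_at_eq [OF assms] D.sum D.scaleR)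
qed

lemma C1_onI:
  assumes "open S"
    and deriv: "\<And>q. q \<in> S \<Longrightarrow> (f has_derivative D q) (at q)"
    and cont: "\<And>e. continuous_on S (\<lambda>q. D q e)"
  shows "C1_on S f"
  unfolding C1_on_def
proof (intro conjI ballI)
  fix u
  show "(\<lambda>t. f (q + t *\<^sub>R qunit u)) differentiable (at 0)" if "q \<in> S" for q
    using has_vector_derivative_along_line [OF deriv [OF that]]
    by (rule differentiableI_vector)
  show "continuous_on S (pderiv_at u f)"
    using cont [of "qunit u"]
    by (rule continuous_on_eq) (simp add: pderiv_at_eq [OF deriv])
qed (fact \<open>open S\<close>)

text \<open>Total derivative from the product rule. As quaternions do not commute, the inverse of v
  contributes the two-sided term - (1/v) dv (1/v).\<close>

definition mu_deriv :: "nat \<Rightarrow> quat \<Rightarrow> quat \<Rightarrow> quat" where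
  "mu_deriv u q e =
     coord u q *\<^sub>R (coord 0 q *\<^sub>R
         - (inverse (vec_part q) * vec_part e * inverse (vec_part q))
       + coord 0 e *\<^sub>R inverse (vec_part q))
     + coord u e *\<^sub>R (1 + coord 0 q *\<^sub>R inverse (vec_part q))"

lemma has_derivative_mu:
  assumes "q \<in> Hstar"
  shows "(mu u has_derivative mu_deriv u q) (at q)"
proof -
  have "vec_part q \<noteq> 0"
    using assms by (simp add: Hstar_def)
  moreover have "(coord k has_derivative coord k) (at q)" for k
    by (rule bounded_linear_imp_has_derivative [OF bounded_linear_coord])
  moreover have "(vec_part has_derivative vec_part) (at q)"
    by (rule bounded_linear_imp_has_derivative [OF bounded_linear_vec_part])
  ultimately show ?thesis
    unfolding mu_def [abs_def] mu_deriv_def [abs_def]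
    by (auto intro!: derivative_eq_intros)
qed

lemma continuous_on_mu_deriv: "continuous_on Hstar (\<lambda>q. mu_deriv u q e)"
  unfolding mu_deriv_def by (intro continuous_intros) (auto simp: Hstar_def)

theorem theorem1p3:
  fixes u :: nat
  assumes "u \<in> {1, 2, 3}"
  shows "V_regular_on Hstar (mu u)"
  unfolding V_regular_on_def
proof (intro conjI ballI)
  show "C1_on Hstar (mu u)"
    by (rule C1_onI [OF open_Hstar has_derivative_mu continuous_on_mu_deriv])
  fix q assume q: "q \<in> Hstar"
  then have "vec_part q \<noteq> 0"
    by (simp add: Hstar_def)
  moreover have "u \<noteq> 0"
    using assms by auto
  \<comment> \<open>In direction v the two-sided term collapses to - 1/v, so the terms with
    \<open>coord 0 q\<close> cancel. In direction \<open>qunit 0 = 1\<close> both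
    \<open>vec_part\<close> and, as \<open>u \<noteq> 0\<close>, \<open>coord u\<close>
    vanish.\<close>
  ultimately have "mu_deriv u q (vec_part q) = of_real (coord u q)"
    and "mu_deriv u q (qunit 0) = coord u q *\<^sub>R inverse (vec_part q)"
    by (simp_all add: mu_deriv_def qunit_def coord_vec_part coord_one
        scaleR_add_right of_real_def)
  then have "pderiv_at 0 (mu u) q = coord u q *\<^sub>R inverse (vec_part q)"
    and "(\<Sum>k=1..3. coord k q *\<^sub>R pderiv_at k (mu u) q) = of_real (coord u q)"
    unfolding sum_coord_pderiv_at [OF has_derivative_mu [OF q]]
    by (simp_all only: pderiv_at_eq [OF has_derivative_mu [OF q]])
  \<comment> \<open>The Euler sum is real, so multiplying it by 1/v just scales 1/v and gives the
    derivative in direction \<open>qunit 0\<close>.\<close>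
  then show "V_op (mu u) q = 0"
    by (simp only: V_op_def) (simp add: of_real_def)
qed simp

end
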